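(* Let $N = k2^n+1$, where $k$ is a positive odd integer and $n$ is a positive integer, and suppose that $2^n > N^{1/3}$. Let $a$ be an integer with Jacobi symbol $\left(\frac{a}{N}\right) = -1$. Let $r = k \bmod 2^n$ and put $$u = \frac{1}{2}\left(r - \sqrt{r^2 - 4\left(\frac{k-r}{2^n}\right)}\right).$$ Then $N$ is prime if and only if both of the following hold: $$a^{\frac{N-1}{2}} \equiv -1 \pmod N \quad\text{and}\quad u \notin \mathbb{N}.$$
   Context: Here $k \bmod 2^n$ denotes the least nonnegative residue of $k$ modulo $2^n$, so that $0 \le k \bmod 2^n < 2^n$ and $(k - (k \bmod 2^n))/2^n$ is a nonnegative integer. $\mathbb{N} = \{1,2,3,\dots\}$ denotes the set of positive integers. If the quantity under the square root is negative, then $u$ is a non-real complex number, and in particular $u \notin \mathbb{N}$. The symbol $\left(\frac{a}{N}\right)$ is the Jacobi symbol (which is the Legendre symbol when $N$ is prime). *)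

theory Defs
  imports "HOL-Analysis.Analysis" "HOL-Number_Theory.Number_Theory"
begin

text \<open>
  The prime factors are taken with multiplicity. The symbol is only meant for odd positive \<open>n\<close>.
\<close>
definition Jacobi :: "int \<Rightarrow> nat \<Rightarrow> int" where
  "Jacobi a n = (\<Prod>p\<in>#prime_factorization n. Legendre a (int p))"

end

theory Submission
  imports Defs
begin

text \<open>
  Put \<open>M = 2 ^ n\<close>. If \<open>a ^ ((N - 1) div 2) \<equiv> -1\<close> modulo \<open>N\<close>, then \<open>a ^ k\<close> has order exactly
  \<open>M\<close> modulo every prime factor of \<open>N\<close>, so every divisor of \<open>N\<close> is \<open>1\<close> modulo \<open>M\<close>.
  A nontrivial factorisation therefore has the form \<open>N = (x * M + 1) * (y * M + 1)\<close>, that is,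
  \<open>k = x * y * M + (x + y)\<close>. Since \<open>N < M ^ 3\<close>, this is the division of \<open>k\<close> by \<open>M\<close> with remainder,
  and so \<open>x\<close> and \<open>y\<close> are the roots of \<open>X\<^sup>2 - r * X + k div M\<close>, of which \<open>u\<close> is the smaller one.
\<close>

text \<open>The order of \<open>b\<close> modulo \<open>p\<close> divides \<open>2 ^ Suc n\<close>,
  as squaring -1 gives 1, but not \<open>2 ^ n\<close>, as -1 and 1 differ modulo
  \<open>p > 2\<close>. So it equals \<open>2 ^ Suc n\<close>, and it divides
  \<open>p - 1\<close>.\<close>

lemma prime_cong_1_if_power_2_power_cong_minus_1:
  fixes b :: int
  assumes p: "prime p" "2 < p" and b: "[b ^ (2 ^ n) = -1] (mod int p)"
  shows "[p = 1] (mod 2 ^ Suc n)"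
proof -
  \<comment> \<open>\<open>ord\<close> works on naturals, so \<open>b\<close> is replaced by its
    least nonnegative residue.\<close>
  define c where "c = nat (b mod int p)"
  have c: "int c = b mod int p"
    using p by (simp add: c_def)
  have pow: "[int c ^ j = b ^ j] (mod int p)" for j
    unfolding c by (simp add: cong_def power_mod)
  have minus1: "[int c ^ (2 ^ n) = -1] (mod int p)"
    using cong_trans[OF pow b] .
  have "[(int c ^ (2 ^ n)) ^ 2 = (-1) ^ 2] (mod int p)"
    using minus1 by (rule cong_pow)
  then have "[int (c ^ (2 ^ Suc n)) = int 1] (mod int p)"
    by (simp flip: power_mult add: mult.commute)
  then have one: "[c ^ (2 ^ Suc n) = 1] (mod p)"
    by (simp only: cong_int_iff)
  have "\<not> [c ^ (2 ^ n) = 1] (mod p)"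
  proof
    assume "[c ^ (2 ^ n) = 1] (mod p)"
    then have "[int c ^ (2 ^ n) = 1] (mod int p)"
      by (metis cong_int_iff of_nat_1 of_nat_power)
    then have "[-1 = (1::int)] (mod int p)"
      using minus1 cong_sym cong_trans by blast
    then have "int p dvd 2"
      by (simp add: cong_iff_dvd_diff)
    then show False
      using p zdvd_imp_le[of "int p" 2] by simp
  qed
  then have not_dvd: "\<not> ord p c dvd 2 ^ n"
    by (simp only: ord_divides simp_thms)
  have "ord p c dvd 2 ^ Suc n"
    using one by (simp only: ord_divides)
  then obtain j where j: "j \<le> Suc n" "ord p c = 2 ^ j"
    using divides_primepow_nat[OF two_is_prime_nat] by blast
  with not_dvd have "ord p c = 2 ^ Suc n"
    by (metis le_SucE le_imp_power_dvd)
  moreover have "coprime p c"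
  proof (rule ccontr)
    assume "\<not> coprime p c"
    then have "p dvd c ^ (2 ^ Suc n)"
      using p prime_imp_coprime[of p c] by (auto simp: prime_dvd_power_nat_iff)
    then show False
      using one p by (metis cong_dvd_iff not_prime_unit)
  qed
  then have "ord p c dvd p - 1"
    using p order_divides_totient[of p c] by (simp add: totient_prime)
  ultimately show ?thesis
    using p by (simp add: cong_altdef_nat)
qed

lemma cong_1_if_prime_divisors_cong_1:
  fixes d m :: nat
  assumes "d > 0" and "\<And>p. prime p \<Longrightarrow> p dvd d \<Longrightarrow> [p = 1] (mod m)"
  shows "[d = 1] (mod m)"
  using assms
proof (induction d rule: prime_divisors_induct)
  case (factor p d)
  then have "[p * d = 1 * 1] (mod m)"
    by (intro cong_mult) auto
  then show ?case by simp
qed auto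

text \<open>The left-hand side is a root of \<open>X^2 - r * X + q\<close>; the other root is its
  difference from \<open>r\<close>, and the two multiply to \<open>q\<close>.\<close>

lemma smaller_root_positive_nat_iff:
  fixes r q :: nat
  shows "1 / 2 * (of_nat r - csqrt ((of_nat r)\<^sup>2 - 4 * of_nat q)) \<in> of_nat ` {m::nat. m \<ge> 1}
    \<longleftrightarrow> (\<exists>x y. x \<ge> 1 \<and> y \<ge> 1 \<and> r = x + y \<and> q = x * y)"
    (is "?u \<in> _ \<longleftrightarrow> _")
proof
  assume "?u \<in> of_nat ` {m::nat. m \<ge> 1}"
  then obtain m :: nat where m: "m \<ge> 1" "?u = of_nat m" by auto
  then have sqrt: "csqrt ((of_nat r)\<^sup>2 - 4 * of_nat q) = of_nat r - 2 * of_nat m"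
    by (simp add: field_simps)
  then have "(of_nat r)\<^sup>2 - 4 * of_nat q = (of_nat r - 2 * of_nat m :: complex)\<^sup>2"
    by (metis power2_csqrt)
  \<comment> \<open>The identity is pulled back to the integers first, because \<open>m < r\<close>
    is not known yet.\<close>
  then have "of_int (4 * int q) = (of_int (4 * (int m * (int r - int m))) :: complex)"
    by (simp add: power2_eq_square algebra_simps)
  then have "4 * int q = 4 * (int m * (int r - int m))"
    by (simp only: of_int_eq_iff)
  then have q: "int q = int m * (int r - int m)"
    by simp
  \<comment> \<open>For \<open>q = 0\<close> the principal branch of \<open>csqrt\<close> returns
    \<open>r\<close> itself, so the root would be 0 and not positive.\<close>
  have "q \<noteq> 0"
  proof
    assume "q = 0"
    with q m have "r = m" by auto
    with sqrt \<open>q = 0\<close> have "csqrt ((of_nat m)\<^sup>2) = - of_nat m"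
      by simp
    moreover have "csqrt ((of_nat m)\<^sup>2) = of_nat m"
      using m by (intro csqrt_square) auto
    ultimately show False
      using m by simp
  qed
  with q have "0 < int m * (int r - int m)"
    by linarith
  with m have "m < r"
    by (simp add: zero_less_mult_iff)
  with q have "q = m * (r - m)"
    by (metis less_imp_le of_nat_diff of_nat_eq_iff of_nat_mult)
  with m \<open>m < r\<close> show "\<exists>x y. x \<ge> 1 \<and> y \<ge> 1 \<and> r = x + y \<and> q = x * y"
    by (intro exI[of _ m] exI[of _ "r - m"]) auto
next
  \<comment> \<open>With \<open>x \<le> y\<close> the discriminant is the square of the natural
    number \<open>y - x\<close>, which is the root that \<open>csqrt\<close> picks.\<close>
  have *: "?u \<in> of_nat ` {m::nat. m \<ge> 1}"
    if "x \<ge> 1" "x \<le> y" "r = x + y" "q = x * y" for x y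
  proof -
    have "(of_nat r)\<^sup>2 - 4 * of_nat q = (of_nat (y - x) :: complex)\<^sup>2"
      using that by (simp add: of_nat_diff power2_eq_square algebra_simps)
    moreover have "csqrt ((of_nat (y - x))\<^sup>2) = of_nat (y - x)"
      by (cases "y = x") (auto intro: csqrt_square simp del: of_nat_diff)
    ultimately have "?u = 1 / 2 * (of_nat r - of_nat (y - x))"
      by simp
    also have "\<dots> = of_nat x"
      using that by (simp add: of_nat_diff)
    finally show ?thesis
      using that(1) by blast
  qed
  assume "\<exists>x y. x \<ge> 1 \<and> y \<ge> 1 \<and> r = x + y \<and> q = x * y"
  then obtain x y where xy: "x \<ge> 1" "y \<ge> 1" "r = x + y" "q = x * y"
    by auto
  then show "?u \<in> of_nat ` {m::nat. m \<ge> 1}"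
    using *[of x y] *[of y x] by (cases "x \<le> y") (simp_all add: ac_simps)
qed

text \<open>Expanding the product gives \<open>k = x * y * M + (x + y)\<close>. The bound on
  \<open>k\<close> forces \<open>x + y < M\<close>, so this is division with remainder.\<close>

lemma div_mod_eq_prod_sum_iff:
  fixes k M :: nat
  assumes k: "k < M\<^sup>2" and xy: "x \<ge> 1" "y \<ge> 1"
  shows "k mod M = x + y \<and> k div M = x * y \<longleftrightarrow> k * M + 1 = (x * M + 1) * (y * M + 1)"
proof -
  have M: "M > 0"
    using k by (cases M) auto
  have "k * M + 1 = (x * M + 1) * (y * M + 1) \<longleftrightarrow> k * M = (x * y * M + (x + y)) * M"
    by (simp add: algebra_simps)
  also have "\<dots> \<longleftrightarrow> k = x * y * M + (x + y)"
    using M by simp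
  also have "\<dots> \<longleftrightarrow> k mod M = x + y \<and> k div M = x * y"
  proof
    assume "k mod M = x + y \<and> k div M = x * y"
    then show "k = x * y * M + (x + y)"
      by (metis div_mult_mod_eq)
  next
    assume eq: "k = x * y * M + (x + y)"
    then have "x * y * M < k"
      using xy by simp
    also have "k < M * M"
      using k by (simp add: power2_eq_square)
    finally have lt: "x * y < M" by simp
    obtain x' y' where x': "x = Suc x'" "y = Suc y'"
      using xy by (metis Suc_le_D One_nat_def)
    \<comment> \<open>This is \<open>(x - 1) * (y - 1) \<ge> 0\<close>. With
      \<open>x * y < M\<close> it yields only \<open>x + y \<le> M\<close>, so equality is excluded
      separately.\<close>
    have le: "x + y \<le> x * y + 1"
      by (simp add: x')
    have "x + y \<noteq> M"
    proof
      assume sum: "x + y = M"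
      with lt le have "M = x * y + 1" by simp
      then have "k = M\<^sup>2"
        unfolding eq sum by (simp add: power2_eq_square)
      with k show False by simp
    qed
    with lt le have "x + y < M" by simp
    with eq M show "k mod M = x + y \<and> k div M = x * y"
      by simp
  qed
  finally show ?thesis by blast
qed

theorem theorem3:
  fixes N k n r :: nat and a :: int and u :: complex
  assumes N: "N = k * 2 ^ n + 1"
    and k: "k > 0" "odd k"
    and n: "n > 0"
    and bound: "(2::real) ^ n > real N powr (1 / 3)"
    and a: "Jacobi a N = -1"
    and r: "r = k mod 2 ^ n"
    and u: "u = 1 / 2 * (of_nat r - csqrt ((of_nat r)\<^sup>2 - 4 * ((of_nat k - of_nat r) / 2 ^ n)))"
  shows "prime N \<longleftrightarrow>
    [a ^ ((N - 1) div 2) = -1] (mod int N) \<and> u \<notin> of_nat ` {m::nat. m \<ge> 1}"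
proof -
  define M :: nat where "M = 2 ^ n"
  have NM: "N = k * M + 1"
    by (simp add: N M_def)
  have M: "even M" "M > 0"
    using n by (auto simp: M_def)
  then have "odd N"
    by (simp add: NM)
  have "1 * 2 \<le> k * M"
    using k M by (intro mult_le_mono) (auto elim!: evenE)
  then have "N > 2"
    by (simp add: NM)
  have "k < M\<^sup>2"
  proof -
    have "real N = (real N powr (1 / 3)) ^ 3"
      using \<open>N > 2\<close> by (simp flip: powr_realpow add: powr_powr)
    also have "\<dots> < (2 ^ n) ^ 3"
      using bound by (intro power_strict_mono) auto
    also have "\<dots> = real (M ^ 3)"
      by (simp add: M_def)
    finally have "N < M ^ 3"
      by (simp only: of_nat_less_iff)
    then have "k * M < M\<^sup>2 * M"
      unfolding NM power2_eq_square power3_eq_cube by linarith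
    then show ?thesis by simp
  qed
  have "of_nat k - of_nat r = (of_nat (k div M) * 2 ^ n :: complex)"
  proof -
    have "k = k div M * M + r"
      unfolding r M_def by (rule div_mult_mod_eq[symmetric])
    then have "(of_nat k :: complex) = of_nat (k div M * M + r)"
      by simp
    then show ?thesis
      by (simp add: M_def)
  qed
  then have "u = 1 / 2 * (of_nat r - csqrt ((of_nat r)\<^sup>2 - 4 * of_nat (k div M)))"
    by (simp add: u)
  \<comment> \<open>This equivalence serves both directions: a positive integer \<open>u\<close>
    amounts to a factorisation of \<open>N\<close> into two nontrivial factors that are 1 modulo
    \<open>M\<close>.\<close>
  then have u_iff: "u \<in> of_nat ` {m::nat. m \<ge> 1} \<longleftrightarrow>
      (\<exists>x y. x \<ge> 1 \<and> y \<ge> 1 \<and> N = (x * M + 1) * (y * M + 1))"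
    using div_mod_eq_prod_sum_iff[OF \<open>k < M\<^sup>2\<close>]
    by (simp only: smaller_root_positive_nat_iff NM r flip: M_def) metis
  show ?thesis
  proof (intro iffI conjI)
    assume prime: "prime N"
    then have "Legendre a (int N) = -1"
      using a by (simp add: Jacobi_def prime_factorization_prime)
    then show "[a ^ ((N - 1) div 2) = -1] (mod int N)"
      using euler_criterion[of N a] prime \<open>N > 2\<close> by (simp add: cong_sym)
    show "u \<notin> of_nat ` {m::nat. m \<ge> 1}"
    proof
      assume "u \<in> of_nat ` {m::nat. m \<ge> 1}"
      then obtain x y where xy: "x \<ge> 1" "y \<ge> 1" "N = (x * M + 1) * (y * M + 1)"
        using u_iff by blast
      then have "x * M + 1 = 1 \<or> y * M + 1 = 1"
        using prime prime_product by blast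
      with xy M show False by simp
    qed
  next
    assume asm: "[a ^ ((N - 1) div 2) = -1] (mod int N) \<and> u \<notin> of_nat ` {m::nat. m \<ge> 1}"
    \<comment> \<open>Halving costs one factor 2; the order argument applied with
      \<open>n - 1\<close> regains it and gives the full modulus \<open>M\<close>.\<close>
    have exponent: "a ^ ((N - 1) div 2) = (a ^ k) ^ 2 ^ (n - 1)"
      using n by (cases n) (simp_all add: N flip: power_mult)
    have dvd_cong: "[d = 1] (mod M)" if "d dvd N" for d
    proof (rule cong_1_if_prime_divisors_cong_1)
      show "d > 0"
        using that \<open>N > 2\<close> by (auto intro: Nat.gr0I)
      fix p assume p: "prime p" "p dvd d"
      with that have "p dvd N" by auto
      with \<open>odd N\<close> p have "2 < p"
        using prime_ge_2_nat[of p] by (cases "p = 2") auto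
      moreover have "[(a ^ k) ^ 2 ^ (n - 1) = -1] (mod int p)"
        using asm \<open>p dvd N\<close> unfolding exponent
        by (meson cong_dvd_modulus of_nat_dvd_iff)
      ultimately have "[p = 1] (mod 2 ^ Suc (n - 1))"
        using prime_cong_1_if_power_2_power_cong_minus_1 p by blast
      then show "[p = 1] (mod M)"
        using n by (simp add: M_def)
    qed
    \<comment> \<open>The condition \<open>d > 1\<close> rules out \<open>x = 0\<close>, as
      \<open>u_iff\<close> requires.\<close>
    have dvd_form: "\<exists>x\<ge>1. d = x * M + 1" if "d dvd N" "d > 1" for d
    proof -
      have "M dvd d - 1"
        using dvd_cong[OF that(1)] that(2) by (simp add: cong_altdef_nat)
      then obtain x where x: "d - 1 = M * x" ..
      with that have "x \<ge> 1" "d = x * M + 1"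
        by (cases x; simp add: mult.commute)+
      then show ?thesis by blast
    qed
    show "prime N"
    proof (rule ccontr)
      assume "\<not> prime N"
      then obtain d where "d dvd N" "d \<noteq> 1" "d \<noteq> N"
        using \<open>N > 2\<close> by (auto simp: prime_nat_iff)
      moreover from \<open>d dvd N\<close> obtain e where "N = d * e" ..
      ultimately have de: "N = d * e" "d > 1" "e > 1"
        using \<open>N > 2\<close> by (auto simp: nat_neq_iff)
      then obtain x y where "x \<ge> 1" "y \<ge> 1" "d = x * M + 1" "e = y * M + 1"
        using dvd_form[of d] dvd_form[of e] by auto
      with de asm u_iff show False by blast
    qed
  qed
qed

end
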